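(* As $k\to\infty$, $$s_k^{\mathtt{ST}}\le\sqrt{k}\,(1+o_k(1)).$$ Apart from the error term, this bound is best possible, that is, $s_k^{\mathtt{ST}}\ge\sqrt{k}\,(1-o_k(1))$.
   Context: $|x-y|$ denotes Euclidean distance. For a finite set $X\subseteq[0,1]^k$ with $|X|\ge 2$ and a spanning tree $T$ of the complete graph on $X$, let $s_k(T)=\left(\sum_{xy\in E(T)}|x-y|^k\right)^{1/k}$. Let $s_k^{\mathtt{ST}}(X)$ be the minimum of $s_k(T)$ over all spanning trees $T$ on $X$, $s_k^{\mathtt{ST}}(n)=\sup\{s_k^{\mathtt{ST}}(X):X\subseteq[0,1]^k,\ |X|=n\}$, and $s_k^{\mathtt{ST}}=\sup_{n\ge 2}s_k^{\mathtt{ST}}(n)$. The notation $o_k(1)$ denotes a quantity depending only on $k$ that tends to $0$ as $k\to\infty$. *)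

theory Defs
  imports "HOL-Analysis.Analysis"
begin

text \<open>
  The dimension varies inside the statement, so a point of \<open>[0,1]^k\<close> is a function
  \<open>nat \<Rightarrow> real\<close> that takes values in \<open>[0,1]\<close> on \<open>{..<k}\<close> and is \<open>undefined\<close> elsewhere
  (extensionality makes distinct functions distinct points, so \<open>card\<close> counts points).
\<close>

definition unit_cube :: "nat \<Rightarrow> (nat \<Rightarrow> real) set" where
  "unit_cube k = (\<Pi>\<^sub>E i\<in>{..<k}. {0..1})"

definition edist :: "nat \<Rightarrow> (nat \<Rightarrow> real) \<Rightarrow> (nat \<Rightarrow> real) \<Rightarrow> real" where
  "edist k x y = L2_set (\<lambda>i. x i - y i) {..<k}"

definition complete_edges :: "'a set \<Rightarrow> 'a set set" where
  "complete_edges X = {{x, y} | x y. x \<in> X \<and> y \<in> X \<and> x \<noteq> y}"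

definition graph_connected :: "'a set \<Rightarrow> 'a set set \<Rightarrow> bool" where
  "graph_connected X T \<longleftrightarrow> X \<noteq> {} \<and> (\<forall>x\<in>X. \<forall>y\<in>X. (x, y) \<in> {(u, v). {u, v} \<in> T}\<^sup>*)"

definition graph_cycle :: "'a set set \<Rightarrow> 'a list \<Rightarrow> bool" where
  "graph_cycle T p \<longleftrightarrow> 3 \<le> length p \<and> distinct p \<and>
     (\<forall>i<length p. {p ! i, p ! (Suc i mod length p)} \<in> T)"

text \<open>
  Trees are identified with their edge sets.
\<close>

definition spanning_tree_on :: "'a set \<Rightarrow> 'a set set \<Rightarrow> bool" where
  "spanning_tree_on X T \<longleftrightarrow>
     T \<subseteq> complete_edges X \<and> graph_connected X T \<and> (\<nexists>p. graph_cycle T p)"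

definition edge_length :: "nat \<Rightarrow> (nat \<Rightarrow> real) set \<Rightarrow> real" where
  "edge_length k e = (THE d. \<exists>x y. e = {x, y} \<and> d = edist k x y)"

lemma edist_commute: "edist k x y = edist k y x"
  by (simp add: edist_def L2_set_def power2_commute)

lemma edge_length_doubleton [simp]: "edge_length k {x, y} = edist k x y"
  unfolding edge_length_def
  by (rule the_equality) (auto simp: doubleton_eq_iff edist_commute)

definition tree_cost :: "nat \<Rightarrow> (nat \<Rightarrow> real) set set \<Rightarrow> real" where
  "tree_cost k T = root k (\<Sum>e\<in>T. edge_length k e ^ k)"

definition sST_set :: "nat \<Rightarrow> (nat \<Rightarrow> real) set \<Rightarrow> real" where
  "sST_set k X = Min (tree_cost k ` {T. spanning_tree_on X T})"

text \<open>
  The suprema are taken in \<open>ereal\<close>, so that their finiteness is not presupposed.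
\<close>

definition sST_num :: "nat \<Rightarrow> nat \<Rightarrow> ereal" where
  "sST_num k n = (SUP X\<in>{X. X \<subseteq> unit_cube k \<and> card X = n}. ereal (sST_set k X))"

definition sST :: "nat \<Rightarrow> ereal" where
  "sST k = (SUP n\<in>{2..}. sST_num k n)"

end

theory Submission
  imports Defs
begin

text \<open>
  Two opposite corners of the cube give the lower bound \<open>sqrt k\<close>. For the upper bound take a
  spanning tree minimising the sum of \<open>k\<close>-th powers and put \<open>c e = |e| / sqrt k\<close>; the sum of
  \<open>c e ^ k\<close> over all edges is bounded by an absolute constant.

  Deleting an edge \<open>e\<close> leaves two parts at distance at least \<open>|e|\<close>. Hence the edges have
  distinct representing vertices with \<open>|v e - v f| \<ge> min |e| |f|\<close>, and their midpoints satisfy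
  \<open>|m e - m f| \<ge> max |e| |f| / 2\<close>. Blichfeldt's inequality turns such separation into packing
  bounds. For the lengths with \<open>c e \<ge> 0.18\<close>, which are grouped into finitely many intervals, cut the
  cube into boxes of circumradius just below \<open>1 / sqrt 2\<close> times the separation: each box contains
  boundedly many representatives, and the number of boxes is at most \<open>(1 / c)^k\<close> up to a constant.
  For the short edges, integrate Blichfeldt's inequality for the midpoints over a slightly enlarged
  cube; this treats all scales at once.
\<close>

subsection \<open>Connected edge sets of minimal weight\<close>

definition reach :: "'a set set \<Rightarrow> 'a \<Rightarrow> 'a \<Rightarrow> bool" where
  "reach T u v \<longleftrightarrow> (u, v) \<in> {(u, v). {u, v} \<in> T}\<^sup>*"

lemma reach_refl [simp]: "reach T u u"
  by (simp add: reach_def)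

lemma reach_edge: "{u, v} \<in> T \<Longrightarrow> reach T u v"
  by (auto simp: reach_def)

lemma reach_trans: "reach T u v \<Longrightarrow> reach T v x \<Longrightarrow> reach T u x"
  by (auto simp: reach_def)

lemma reach_sym: "reach T u v \<Longrightarrow> reach T v u"
proof -
  have "sym ({(u, v). {u, v} \<in> T}\<^sup>*)"
    by (rule sym_rtrancl) (auto simp: sym_def insert_commute)
  then show "reach T u v \<Longrightarrow> reach T v u"
    by (auto simp: reach_def dest: symD)
qed

lemma reach_common: "reach T u x \<Longrightarrow> reach T v x \<Longrightarrow> reach T u v"
  by (rule reach_trans[OF _ reach_sym])

lemma reach_induct [consumes 1, case_names refl step]:
  assumes "reach T u v" and "P u"
    and "\<And>x y. reach T u x \<Longrightarrow> {x, y} \<in> T \<Longrightarrow> P x \<Longrightarrow> P y"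
  shows "P v"
  using assms(1) unfolding reach_def
  by (induction rule: rtrancl_induct) (use assms(2,3) in \<open>auto simp: reach_def\<close>)

lemma reach_mono: "reach S u v \<Longrightarrow> S \<subseteq> T \<Longrightarrow> reach T u v"
proof (induction rule: reach_induct)
  case (step x y)
  then show ?case using reach_trans[OF _ reach_edge, of T u x y] by blast
qed simp

lemma graph_connected_iff_reach:
  "graph_connected X T \<longleftrightarrow> X \<noteq> {} \<and> (\<forall>x\<in>X. \<forall>y\<in>X. reach T x y)"
  by (simp add: graph_connected_def reach_def)

lemma complete_edgesE:
  assumes "e \<in> complete_edges X"
  obtains x y where "e = {x, y}" "x \<in> X" "y \<in> X" "x \<noteq> y"
  using assms by (auto simp: complete_edges_def)

lemma finite_complete_edges: "finite X \<Longrightarrow> finite (complete_edges X)"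
  by (rule finite_subset[of _ "Pow X"]) (auto simp: complete_edges_def)

lemma graph_connected_complete_edges: "X \<noteq> {} \<Longrightarrow> graph_connected X (complete_edges X)"
proof -
  have "reach (complete_edges X) x y" if "x \<in> X" "y \<in> X" for x y
    by (cases "x = y") (use that in \<open>auto intro!: reach_edge simp: complete_edges_def\<close>)
  then show "X \<noteq> {} \<Longrightarrow> ?thesis" by (simp add: graph_connected_iff_reach)
qed

lemma finite_spanning_trees: "finite X \<Longrightarrow> finite {T. spanning_tree_on X T}"
  by (rule finite_subset[of _ "Pow (complete_edges X)"])
    (auto simp: spanning_tree_on_def finite_complete_edges)

text \<open>Minimality ranges over connected edge sets instead of trees, so an exchange only has to
  preserve connectivity. Since weights are positive, acyclicity follows in
  \<open>spanning_tree\<close>.\<close>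

locale min_connected =
  fixes X :: "'a set" and T :: "'a set set" and w :: "'a set \<Rightarrow> real"
  assumes finite_X: "finite X"
    and edges: "T \<subseteq> complete_edges X"
    and connected: "graph_connected X T"
    and pos: "\<And>e. e \<in> complete_edges X \<Longrightarrow> 0 < w e"
    and minimal: "\<And>T'. T' \<subseteq> complete_edges X \<Longrightarrow> graph_connected X T' \<Longrightarrow> sum w T \<le> sum w T'"
begin

lemma finite_T: "finite T"
  using edges finite_X finite_complete_edges finite_subset by blast

lemma reach_all: "x \<in> X \<Longrightarrow> y \<in> X \<Longrightarrow> reach T x y"
  using connected by (auto simp: graph_connected_iff_reach)

lemma edgeE:
  assumes "e \<in> T"
  obtains a b where "e = {a, b}" "a \<in> X" "b \<in> X" "a \<noteq> b"
  using assms edges by (blast elim: complete_edgesE)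

text \<open>Follow a walk from \<open>a\<close> to \<open>u\<close>: each time it crosses the
  deleted edge it stands at \<open>a\<close> or \<open>b\<close> and can be restarted there.\<close>

lemma reach_del_endpoint:
  assumes "{a, b} \<in> T" "u \<in> X"
  shows "reach (T - {{a, b}}) u a \<or> reach (T - {{a, b}}) u b"
proof -
  have "a \<in> X" using assms(1) edges by (auto simp: complete_edges_def doubleton_eq_iff)
  then have "reach T a u" using assms(2) reach_all by blast
  then have "reach (T - {{a, b}}) a u \<or> reach (T - {{a, b}}) b u"
  proof (induction rule: reach_induct)
    case (step x y)
    show ?case
    proof (cases "{x, y} = {a, b}")
      case True
      then show ?thesis by (auto simp: doubleton_eq_iff)
    next
      case False
      then have "reach (T - {{a, b}}) x y" using step by (intro reach_edge) auto
      then show ?thesis using step.IH reach_trans[of _ _ x y] by blast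
    qed
  qed auto
  then show ?thesis by (auto dest: reach_sym)
qed

text \<open>Otherwise the edge could be dropped without disconnecting anything, which saves its
  positive weight.\<close>

lemma not_reach_del:
  assumes "{a, b} \<in> T"
  shows "\<not> reach (T - {{a, b}}) a b"
proof
  assume r: "reach (T - {{a, b}}) a b"
  have "graph_connected X (T - {{a, b}})"
    unfolding graph_connected_iff_reach
  proof (intro conjI ballI)
    show "X \<noteq> {}" using connected by (auto simp: graph_connected_def)
    fix x y assume "x \<in> X" "y \<in> X"
    then have "reach (T - {{a, b}}) x a" "reach (T - {{a, b}}) y a"
      using reach_del_endpoint[OF assms] reach_trans[OF _ reach_sym[OF r]] by blast+
    then show "reach (T - {{a, b}}) x y" by (rule reach_common)
  qed
  then have "sum w T \<le> sum w (T - {{a, b}})" using edges by (intro minimal) auto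
  also have "\<dots> = sum w T - w {a, b}" using assms finite_T by (simp add: sum_diff1)
  finally show False using pos[OF subsetD[OF edges assms]] by simp
qed

text \<open>Exchange argument: \<open>x\<close> and \<open>y\<close> lie on different sides of
  \<open>e\<close>, so replacing \<open>e\<close> by \<open>{x, y}\<close> keeps the set connected
  and cannot lower the total weight.\<close>

lemma cut_weight:
  assumes "e \<in> T" "x \<in> X" "y \<in> X" and nr: "\<not> reach (T - {e}) x y"
  shows "w e \<le> w {x, y}"
proof -
  obtain a b where e: "e = {a, b}" using edgeE[OF assms(1)] by metis
  have xy: "x \<noteq> y" using nr by auto
  have new: "{x, y} \<notin> T - {e}" using nr reach_edge by metis
  let ?T = "insert {x, y} (T - {e})"
  have mono: "reach (T - {e}) u v \<Longrightarrow> reach ?T u v" for u v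
    by (rule reach_mono) auto
  have xy': "reach ?T x y" by (rule reach_edge) auto
  have side: "reach ?T u a \<or> reach ?T u b" if "u \<in> X" for u
    using reach_del_endpoint[of a b u] assms(1) that e mono by auto
  have "\<not> (reach (T - {e}) x a \<and> reach (T - {e}) y a)" "\<not> (reach (T - {e}) x b \<and> reach (T - {e}) y b)"
    using nr reach_common[of "T - {e}" x _ y] by blast+
  then have "reach (T - {e}) x a \<and> reach (T - {e}) y b \<or> reach (T - {e}) x b \<and> reach (T - {e}) y a"
    using reach_del_endpoint[of a b x] reach_del_endpoint[of a b y] assms e by auto
  then have "reach ?T x a \<and> reach ?T y b \<or> reach ?T x b \<and> reach ?T y a"
    using mono by blast
  then have ab: "reach ?T a b"
    by (elim disjE conjE) (rule reach_trans[OF reach_trans[OF reach_sym xy']],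
      assumption+, rule reach_trans[OF reach_trans[OF reach_sym reach_sym[OF xy']]], assumption+)
  have "graph_connected X ?T"
    unfolding graph_connected_iff_reach
  proof (intro conjI ballI)
    show "X \<noteq> {}" using assms by auto
    fix u v assume "u \<in> X" "v \<in> X"
    then have "reach ?T u a" "reach ?T v a"
      using side reach_trans[OF _ reach_sym[OF ab]] by blast+
    then show "reach ?T u v" by (rule reach_common)
  qed
  moreover have "?T \<subseteq> complete_edges X"
    using edges assms xy by (auto simp: complete_edges_def)
  ultimately have "sum w T \<le> sum w ?T" by (rule minimal[rotated])
  then show ?thesis using finite_T assms(1) new by (simp add: sum_diff1)
qed

lemma spanning_tree: "spanning_tree_on X T"
  unfolding spanning_tree_on_def
proof (intro conjI notI)
  show "T \<subseteq> complete_edges X" "graph_connected X T" by (fact edges connected)+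
  assume "\<exists>p. graph_cycle T p"
  then obtain p where p: "3 \<le> length p" "distinct p"
    and cyc: "\<And>i. i < length p \<Longrightarrow> {p ! i, p ! (Suc i mod length p)} \<in> T"
    unfolding graph_cycle_def by blast
  define n where "n = length p - 1"
  have n: "length p = Suc n" "n \<ge> 2" using p by (auto simp: n_def)
  have e: "{p ! 0, p ! n} \<in> T" using cyc[of n] n by (simp add: insert_commute)
  have "reach (T - {{p ! 0, p ! n}}) (p ! 0) (p ! i)" if "i \<le> n" for i
    using that
  proof (induction i)
    case (Suc i)
    have "{p ! i, p ! Suc i} \<in> T" using cyc[of i] Suc n by simp
    \<comment> \<open>Because \<open>n \<ge> 2\<close>, no step along the list is the closing edge
      of the cycle; the list therefore bypasses that edge.\<close>
    moreover have "{p ! i, p ! Suc i} \<noteq> {p ! 0, p ! n}"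
      using p(2) Suc.prems n by (auto simp: doubleton_eq_iff nth_eq_iff_index_eq)
    ultimately have "reach (T - {{p ! 0, p ! n}}) (p ! i) (p ! Suc i)"
      by (intro reach_edge) auto
    then show ?case using Suc reach_trans by fastforce
  qed simp
  then show False using not_reach_del[OF e] by blast
qed

text \<open>The facing endpoints are \<open>b\<close> and \<open>c\<close> (possibly equal), the
  outer ones \<open>a\<close> and \<open>d\<close>: deleting \<open>e\<close> cuts \<open>a\<close>
  off from both ends of \<open>f\<close>, and deleting \<open>f\<close> cuts \<open>d\<close> off
  from both ends of \<open>e\<close>. The four inequalities are those that
  \<open>midpoint_separation\<close> consumes.\<close>

lemma edge_pair:
  assumes "e \<in> T" "f \<in> T" "e \<noteq> f"
  obtains a b c d where "e = {a, b}" "f = {c, d}" "{a, b, c, d} \<subseteq> X" "a \<noteq> b" "c \<noteq> d"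
    "w e \<le> w {a, c}" "w f \<le> w {b, d}" "w e \<le> w {a, d}" "w f \<le> w {a, d}"
proof -
  \<comment> \<open>The edge \<open>f\<close> survives the deletion of \<open>e\<close>, so it lies
    in one component, and some end of \<open>e\<close> lies in the other.\<close>
  have side: "\<exists>a b. e = {a, b} \<and> a \<in> X \<and> b \<in> X \<and> a \<noteq> b \<and> (\<forall>x\<in>f. \<not> reach (T - {e}) a x)"
    if ef: "e \<in> T" "f \<in> T" "e \<noteq> f" for e f
  proof -
    obtain a b where ab: "e = {a, b}" "a \<in> X" "b \<in> X" "a \<noteq> b" using edgeE[OF ef(1)] by metis
    obtain c d where cd: "f = {c, d}" "c \<in> X" "d \<in> X" using edgeE[OF ef(2)] by metis
    have r: "reach (T - {e}) c d" using ef cd by (intro reach_edge) auto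
    have nr: "\<not> reach (T - {e}) a b" using not_reach_del ef ab by auto
    have f: "reach (T - {e}) x c" if "x \<in> f" for x using cd r reach_sym[OF r] that by auto
    show ?thesis
    proof (cases "reach (T - {e}) a c")
      case True
      have "\<not> reach (T - {e}) b x" if "x \<in> f" for x
        using nr reach_common[OF True reach_trans[OF _ f[OF that]]] by blast
      moreover have "e = {b, a}" using ab by auto
      ultimately show ?thesis using ab by blast
    next
      case False
      then have "\<not> reach (T - {e}) a x" if "x \<in> f" for x
        using reach_trans[OF _ f[OF that]] by blast
      then show ?thesis using ab by blast
    qed
  qed
  obtain a b where ab: "e = {a, b}" "a \<in> X" "b \<in> X" "a \<noteq> b"
    and na: "\<And>x. x \<in> f \<Longrightarrow> \<not> reach (T - {e}) a x" using side[OF assms] by metis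
  obtain d c where cd: "f = {d, c}" "d \<in> X" "c \<in> X" "d \<noteq> c"
    and nd: "\<And>x. x \<in> e \<Longrightarrow> \<not> reach (T - {f}) d x"
    using side[of f e] assms by metis
  show ?thesis
  proof (rule that[of a b c d])
    show "e = {a, b}" "f = {c, d}" "{a, b, c, d} \<subseteq> X" "a \<noteq> b" "c \<noteq> d" using ab cd by auto
    show "w e \<le> w {a, c}" "w e \<le> w {a, d}"
      using cut_weight[OF assms(1)] na ab cd by auto
    show "w f \<le> w {b, d}" "w f \<le> w {a, d}"
      using cut_weight[OF assms(2), of d] nd ab cd by (auto simp: insert_commute)
  qed
qed

text \<open>
  Each edge is represented by its endpoint on the far side from a fixed root.
\<close>

lemma edge_representatives:
  obtains v where "\<And>e. e \<in> T \<Longrightarrow> v e \<in> X" "inj_on v T"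
    "\<And>e f. e \<in> T \<Longrightarrow> f \<in> T \<Longrightarrow> e \<noteq> f \<Longrightarrow> min (w e) (w f) \<le> w {v e, v f}"
proof -
  obtain r where r: "r \<in> X" using connected by (auto simp: graph_connected_def)
  have "\<exists>b. b \<in> X \<and> (\<exists>a. e = {a, b} \<and> reach (T - {e}) r a) \<and> \<not> reach (T - {e}) r b"
    if e: "e \<in> T" for e
  proof -
    obtain a b where ab: "e = {a, b}" "a \<in> X" "b \<in> X" using edgeE[OF e] by metis
    have "reach (T - {e}) r a \<or> reach (T - {e}) r b" "\<not> reach (T - {e}) a b"
      using reach_del_endpoint[of a b r] not_reach_del[of a b] e r ab by auto
    then have "reach (T - {e}) r a \<and> \<not> reach (T - {e}) r b \<or>
        reach (T - {e}) r b \<and> \<not> reach (T - {e}) r a"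
      using reach_common[OF reach_sym reach_sym, of "T - {e}" r a b] by blast
    moreover have "e = {b, a}" using ab by auto
    ultimately show ?thesis using ab by blast
  qed
  then obtain v where v: "\<And>e. e \<in> T \<Longrightarrow> v e \<in> X"
    and v1: "\<And>e. e \<in> T \<Longrightarrow> \<exists>a. e = {a, v e} \<and> reach (T - {e}) r a"
    and v2: "\<And>e. e \<in> T \<Longrightarrow> \<not> reach (T - {e}) r (v e)"
    by metis
  \<comment> \<open>If \<open>v e\<close> and \<open>v f\<close> stayed joined under both deletions,
    \<open>f\<close> would lie beyond \<open>e\<close>, so the walk from \<open>r\<close> to the
    near end of \<open>e\<close> avoids \<open>f\<close>. Continuing through \<open>e\<close> and
    then to \<open>v f\<close> without \<open>f\<close> contradicts the choice of
    \<open>v f\<close>.\<close>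
  have sep: "\<not> reach (T - {e}) (v e) (v f) \<or> \<not> reach (T - {f}) (v e) (v f)"
    if ef: "e \<in> T" "f \<in> T" "e \<noteq> f" for e f
  proof (rule ccontr)
    assume "\<not> ?thesis"
    then have r1: "reach (T - {e}) (v e) (v f)" and r2: "reach (T - {f}) (v e) (v f)" by auto
    obtain a where a: "e = {a, v e}" "reach (T - {e}) r a" using v1 ef by metis
    obtain c where c: "f = {c, v f}" "reach (T - {f}) r c" using v1 ef by metis
    have "reach (T - {e}) c (v f)" using ef c by (intro reach_edge) auto
    then have "reach (T - {e}) x (v f)" if "x \<in> f" for x
      using that by (subst (asm) c(1)) auto
    then have nf: "\<not> reach (T - {e}) r x" if "x \<in> f" for x
      using that v2[OF ef(1)] reach_common[OF reach_trans r1, of r x] by blast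
    have "reach (T - {f}) r a"
      using a(2)
    proof (induction rule: reach_induct)
      case (step x y)
      then have "x \<notin> f" using nf by blast
      then have "{x, y} \<in> T - {f}" using step by auto
      then show ?case using step.IH reach_trans[OF _ reach_edge] by metis
    qed simp
    moreover have "reach (T - {f}) a (v e)" using ef a by (intro reach_edge) auto
    ultimately have "reach (T - {f}) r (v f)" using r2 by (blast intro: reach_trans[of _ r])
    then show False using v2[OF ef(2)] by blast
  qed
  show ?thesis
  proof (rule that[of v])
    show "inj_on v T" using sep by (metis inj_onI reach_refl)
    show "min (w e) (w f) \<le> w {v e, v f}" if "e \<in> T" "f \<in> T" "e \<noteq> f" for e f
      using sep[OF that] cut_weight[of e "v e" "v f"] cut_weight[of f "v e" "v f"] v that
      by (auto simp: min_le_iff_disj)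
  qed (fact v)
qed

end

lemma min_connected_exists:
  assumes "finite X" "X \<noteq> {}" "\<And>e. e \<in> complete_edges X \<Longrightarrow> 0 < w e"
  obtains T where "min_connected X T w"
proof -
  let ?S = "{T. T \<subseteq> complete_edges X \<and> graph_connected X T}"
  have "finite ?S"
    by (rule finite_subset[of _ "Pow (complete_edges X)"]) (auto simp: finite_complete_edges assms)
  moreover have "complete_edges X \<in> ?S"
    using graph_connected_complete_edges[OF assms(2)] by auto
  ultimately obtain T where T: "T \<in> ?S" "\<And>T'. T' \<in> ?S \<Longrightarrow> sum w T \<le> sum w T'"
    using arg_min_if_finite[of ?S "sum w"] by (metis (no_types, lifting) emptyE linorder_le_less_linear)
  have "min_connected X T w"
    by unfold_locales (use assms T in auto)
  then show ?thesis by (rule that)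
qed

subsection \<open>Packing bounds from Blichfeldt's inequality\<close>

lemma edist_sq: "(edist k x y)\<^sup>2 = (\<Sum>i<k. (x i - y i)\<^sup>2)"
  unfolding edist_def L2_set_def by (intro real_sqrt_pow2 sum_nonneg) auto

lemma edist_nonneg: "0 \<le> edist k x y"
  by (simp add: edist_def)

text \<open>Expanding the squares, the left side is the right side minus
  \<open>2 * (\<Sum>i\<in>I. w i * y i)\<^sup>2\<close>.\<close>

lemma weighted_variance:
  fixes w y :: "'i \<Rightarrow> real"
  assumes "finite I"
  shows "(\<Sum>i\<in>I. \<Sum>j\<in>I. w i * w j * (y i - y j)\<^sup>2) \<le> 2 * sum w I * (\<Sum>i\<in>I. w i * (y i)\<^sup>2)"
proof -
  have "(\<Sum>i\<in>I. \<Sum>j\<in>I. w i * w j * (y i - y j)\<^sup>2)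
      = (\<Sum>i\<in>I. \<Sum>j\<in>I. (w i * (y i)\<^sup>2) * w j + w i * (w j * (y j)\<^sup>2) - 2 * ((w i * y i) * (w j * y j)))"
    by (intro sum.cong refl) (simp add: power2_eq_square algebra_simps)
  also have "\<dots> = 2 * sum w I * (\<Sum>i\<in>I. w i * (y i)\<^sup>2) - 2 * (\<Sum>i\<in>I. w i * y i)\<^sup>2"
  proof -
    have "(\<Sum>i\<in>I. \<Sum>j\<in>I. (w i * (y i)\<^sup>2) * w j) = (\<Sum>i\<in>I. w i * (y i)\<^sup>2) * sum w I"
      and "(\<Sum>i\<in>I. \<Sum>j\<in>I. w i * (w j * (y j)\<^sup>2)) = sum w I * (\<Sum>i\<in>I. w i * (y i)\<^sup>2)"
      and "(\<Sum>i\<in>I. \<Sum>j\<in>I. 2 * ((w i * y i) * (w j * y j))) = 2 * (\<Sum>i\<in>I. w i * y i)\<^sup>2"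
      unfolding power2_eq_square[of "sum _ _"] sum_product by (simp_all add: sum_distrib_left)
    then show ?thesis by (simp add: sum.distrib sum_subtractf)
  qed
  finally show ?thesis by simp
qed

text \<open>
  Blichfeldt's inequality for points with individual separation radii: compare the second moment
  about \<open>z\<close>, taken with weights \<open>1 / (l i)\<^sup>2\<close>, with the mutual squared distances.
\<close>

lemma blichfeldt:
  fixes p :: "'i \<Rightarrow> nat \<Rightarrow> real" and l :: "'i \<Rightarrow> real"
  assumes fin: "finite I" and l: "\<And>i. i \<in> I \<Longrightarrow> 0 < l i" and "0 \<le> c"
    and sep: "\<And>i j. i \<in> I \<Longrightarrow> j \<in> I \<Longrightarrow> i \<noteq> j \<Longrightarrow>
      c * ((l i)\<^sup>2 + (l j)\<^sup>2) / 2 \<le> (edist k (p i) (p j))\<^sup>2"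
  shows "c * (real (card I) - 1) / 2 \<le> (\<Sum>i\<in>I. (edist k z (p i))\<^sup>2 / (l i)\<^sup>2)"
proof (cases "I = {}")
  case True
  then show ?thesis using assms by simp
next
  case False
  define w where "w i = 1 / (l i)\<^sup>2" for i
  define W where "W = sum w I"
  have w: "0 < w i" "w i * (l i)\<^sup>2 = 1" if "i \<in> I" for i using l[OF that] by (auto simp: w_def)
  have W: "W > 0" unfolding W_def using False fin w by (intro sum_pos) auto
  \<comment> \<open>Over all ordered pairs the terms \<open>(w i + w j) / 2\<close> add up to
    \<open>card I * W\<close>; the diagonal correction removes \<open>W\<close>.\<close>
  have "c * (real (card I) - 1) * W = (\<Sum>i\<in>I. \<Sum>j\<in>I. c * ((w i + w j) / 2 - (if i = j then w i else 0)))"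
    using fin
    unfolding sum_distrib_left[symmetric] sum.distrib sum_subtractf sum_divide_distrib[symmetric]
    by (simp add: W_def algebra_simps flip: sum_distrib_left sum_distrib_right)
  also have "\<dots> \<le> (\<Sum>i\<in>I. \<Sum>j\<in>I. w i * w j * (edist k (p i) (p j))\<^sup>2)"
  proof (intro sum_mono)
    fix i j assume ij: "i \<in> I" "j \<in> I"
    show "c * ((w i + w j) / 2 - (if i = j then w i else 0)) \<le> w i * w j * (edist k (p i) (p j))\<^sup>2"
    proof (cases "i = j")
      case False
      \<comment> \<open>The weights are chosen so that
        \<open>w i * w j * ((l i)\<^sup>2 + (l j)\<^sup>2) = w i + w j\<close>, which matches the
        separation hypothesis.\<close>
      have "c * ((w i + w j) / 2) = (c * (w j * (w i * (l i)\<^sup>2) + w i * (w j * (l j)\<^sup>2)) / 2)"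
        using w ij by simp
      also have "\<dots> = w i * w j * (c * ((l i)\<^sup>2 + (l j)\<^sup>2) / 2)"
        by (simp add: algebra_simps)
      also have "\<dots> \<le> w i * w j * (edist k (p i) (p j))\<^sup>2"
        using sep[OF ij False] w[OF ij(1)] w[OF ij(2)] by (intro mult_left_mono) auto
      finally show ?thesis using False by simp
    qed (use w[of i] ij in \<open>auto\<close>)
  qed
  \<comment> \<open>Differences do not change when the origin moves to \<open>z\<close>; after that
    \<open>weighted_variance\<close> applies in each coordinate.\<close>
  also have "\<dots> = (\<Sum>i\<in>I. \<Sum>j\<in>I. \<Sum>n<k. w i * w j * ((z n - p i n) - (z n - p j n))\<^sup>2)"
    unfolding edist_sq sum_distrib_left
    by (intro sum.cong refl) (simp add: power2_commute)
  also have "\<dots> = (\<Sum>i\<in>I. \<Sum>n<k. \<Sum>j\<in>I. w i * w j * ((z n - p i n) - (z n - p j n))\<^sup>2)"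
    by (intro sum.cong refl, rule sum.swap)
  also have "\<dots> = (\<Sum>n<k. \<Sum>i\<in>I. \<Sum>j\<in>I. w i * w j * ((z n - p i n) - (z n - p j n))\<^sup>2)"
    by (rule sum.swap)
  also have "\<dots> \<le> (\<Sum>n<k. 2 * W * (\<Sum>i\<in>I. w i * (z n - p i n)\<^sup>2))"
    unfolding W_def by (intro sum_mono weighted_variance fin)
  also have "\<dots> = 2 * W * (\<Sum>i\<in>I. \<Sum>n<k. w i * (z n - p i n)\<^sup>2)"
    by (subst sum.swap) (simp add: sum_distrib_left)
  also have "(\<Sum>i\<in>I. \<Sum>n<k. w i * (z n - p i n)\<^sup>2) = (\<Sum>i\<in>I. (edist k z (p i))\<^sup>2 / (l i)\<^sup>2)"
    by (simp add: edist_sq w_def sum_divide_distrib)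
  finally have "(c * (real (card I) - 1)) * W \<le> (2 * (\<Sum>i\<in>I. (edist k z (p i))\<^sup>2 / (l i)\<^sup>2)) * W"
    by (simp add: algebra_simps)
  then show ?thesis using W by simp
qed

text \<open>Cut side \<open>i\<close> of the cube into \<open>m i\<close> equal parts. By
  \<open>small\<close>, the squared circumradius of a box is at most
  \<open>(1 - \<eta>) * t\<^sup>2 / 2\<close>, so \<open>blichfeldt\<close> about its centre gives
  \<open>N - 1 \<le> N * (1 - \<eta>)\<close> for the number \<open>N\<close> of points in it, that
  is \<open>N \<le> 1 / \<eta>\<close>.\<close>

lemma packing_card:
  fixes m :: "nat \<Rightarrow> nat"
  assumes S: "finite S" "S \<subseteq> unit_cube k" and m: "\<And>i. i < k \<Longrightarrow> 1 \<le> m i"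
    and "0 < t" "0 < \<eta>"
    and sep: "\<And>x y. x \<in> S \<Longrightarrow> y \<in> S \<Longrightarrow> x \<noteq> y \<Longrightarrow> t \<le> edist k x y"
    and small: "(\<Sum>i<k. 1 / (real (m i))\<^sup>2) / 2 \<le> (1 - \<eta>) * t\<^sup>2"
  shows "real (card S) \<le> (\<Prod>i<k. real (m i)) / \<eta>"
proof -
  \<comment> \<open>The minimum assigns points with a coordinate equal to 1 to the last box.\<close>
  define g where "g x = (\<lambda>i\<in>{..<k}. min (nat \<lfloor>m i * x i\<rfloor>) (m i - 1))" for x :: "nat \<Rightarrow> real"
  let ?G = "\<Pi>\<^sub>E i\<in>{..<k}. {..<m i}"
  have g: "g x \<in> ?G" for x
    unfolding g_def restrict_PiE_iff using m by (fastforce simp: Suc_le_eq min_less_iff_disj)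
  have finG: "finite ?G" by (intro finite_PiE) auto
  have fibre: "real (card {x \<in> S. g x = h}) \<le> 1 / \<eta>" for h
  proof -
    let ?F = "{x \<in> S. g x = h}"
    define z where "z i = (real (h i) + 1 / 2) / m i" for i
    have near: "(edist k z x)\<^sup>2 \<le> (\<Sum>i<k. 1 / (real (m i))\<^sup>2) / 4" if x: "x \<in> ?F" for x
      unfolding edist_sq sum_divide_distrib
    proof (intro sum_mono)
      fix i assume i: "i \<in> {..<k}"
      have mi: "real (m i) \<ge> 1" using m i by auto
      have x01: "0 \<le> x i" "x i \<le> 1" using x S i by (auto simp: unit_cube_def PiE_iff)
      have h: "h i = min (nat \<lfloor>m i * x i\<rfloor>) (m i - 1)" using x i by (auto simp: g_def)
      have "\<bar>h i + 1 / 2 - m i * x i\<bar> \<le> 1 / 2"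
      proof (cases "x i = 1")
        case True
        then have "h i = m i - 1" using h by simp
        then show ?thesis using True mi by (simp add: of_nat_diff)
      next
        case False
        have lt: "m i * x i < m i" using False x01 mi by (simp add: less_le)
        have "\<lfloor>m i * x i\<rfloor> < int (m i)" using lt by (simp add: floor_less_iff)
        then have "h i = nat \<lfloor>m i * x i\<rfloor>" using h by linarith
        moreover have "0 \<le> m i * x i" using x01 by simp
        ultimately have "real (h i) = of_int \<lfloor>m i * x i\<rfloor>" by simp
        then show ?thesis by linarith
      qed
      then have "(h i + 1 / 2 - m i * x i)\<^sup>2 \<le> (1 / 2)\<^sup>2"
        using abs_le_square_iff[of "h i + 1 / 2 - m i * x i" "1 / 2"] by simp
      moreover have "z i - x i = (h i + 1 / 2 - m i * x i) / m i"
        using mi by (simp add: z_def field_simps)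
      ultimately have "(z i - x i)\<^sup>2 \<le> (1 / 2)\<^sup>2 / (real (m i))\<^sup>2"
        by (simp only: power_divide[of _ "real (m i)"] divide_right_mono zero_le_power2)
      then show "(z i - x i)\<^sup>2 \<le> 1 / (real (m i))\<^sup>2 / 4" by (simp add: power_divide)
    qed
    have "1 * (real (card ?F) - 1) / 2 \<le> (\<Sum>x\<in>?F. (edist k z x)\<^sup>2 / t\<^sup>2)"
    proof (rule blichfeldt)
      fix x y assume "x \<in> ?F" "y \<in> ?F" "x \<noteq> y"
      then have "t\<^sup>2 \<le> (edist k x y)\<^sup>2" using sep \<open>0 < t\<close> by (intro power_mono) auto
      then show "1 * (t\<^sup>2 + t\<^sup>2) / 2 \<le> (edist k x y)\<^sup>2" by simp
    qed (use S \<open>0 < t\<close> in auto)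
    also have "\<dots> \<le> (\<Sum>x\<in>?F. (1 - \<eta>) / 2)"
    proof (intro sum_mono)
      fix x assume "x \<in> ?F"
      then have "(edist k z x)\<^sup>2 \<le> (1 - \<eta>) / 2 * t\<^sup>2" using near[of x] small by auto
      then show "(edist k z x)\<^sup>2 / t\<^sup>2 \<le> (1 - \<eta>) / 2" using \<open>0 < t\<close> by (simp add: divide_simps)
    qed
    finally have "real (card ?F) * \<eta> \<le> 1" by (simp add: field_simps)
    then show ?thesis using \<open>0 < \<eta>\<close> by (simp add: field_simps)
  qed
  have "S = (\<Union>h\<in>?G. {x \<in> S. g x = h})" using g by auto
  then have "card S \<le> (\<Sum>h\<in>?G. card {x \<in> S. g x = h})"
    using card_UN_le[OF finG, of "\<lambda>h. {x \<in> S. g x = h}"] by simp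
  then have "real (card S) \<le> (\<Sum>h\<in>?G. real (card {x \<in> S. g x = h}))"
    by (simp only: of_nat_le_iff flip: of_nat_sum)
  also have "\<dots> \<le> (\<Sum>h\<in>?G. 1 / \<eta>)" by (intro sum_mono fibre)
  also have "\<dots> = (\<Prod>i<k. real (m i)) / \<eta>" by (simp add: card_PiE)
  finally show ?thesis .
qed

subsection \<open>Short edges\<close>

text \<open>Fubini together with the fundamental theorem of calculus in each coordinate; the volume
  and the second moment of a box are both instances.\<close>

lemma integral_cell:
  fixes a b :: "nat \<Rightarrow> real" and g G :: "nat \<Rightarrow> real \<Rightarrow> real"
  assumes ab: "\<And>i. i < k \<Longrightarrow> a i \<le> b i"
    and deriv: "\<And>i x. i < k \<Longrightarrow> (G i has_real_derivative g i x) (at x)"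
    and cont: "\<And>i x. i < k \<Longrightarrow> isCont (g i) x"
  shows "has_bochner_integral (\<Pi>\<^sub>M i\<in>{..<k}. lborel)
    (\<lambda>z. \<Prod>i<k. g i (z i) * indicator {a i..b i} (z i)) (\<Prod>i<k. G i (b i) - G i (a i))"
proof -
  interpret product_sigma_finite "\<lambda>_ :: nat. lborel :: real measure"
    by standard
  have 1: "has_bochner_integral lborel (\<lambda>x. g i x * indicator {a i..b i} x) (G i (b i) - G i (a i))"
    if "i < k" for i
    using that assms by (intro has_bochner_integral_FTC_Icc_real) auto
  then have int: "integrable lborel (\<lambda>x. g i x * indicator {a i..b i} x)" if "i \<in> {..<k}" for i
    using that has_bochner_integral_iff by fastforce
  show ?thesis
    unfolding has_bochner_integral_iff
  proof
    show "integrable (\<Pi>\<^sub>M i\<in>{..<k}. lborel) (\<lambda>z. \<Prod>i<k. g i (z i) * indicator {a i..b i} (z i))"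
      using product_integrable_prod[OF finite_lessThan int] by simp
    show "(\<integral>z. (\<Prod>i<k. g i (z i) * indicator {a i..b i} (z i)) \<partial>(\<Pi>\<^sub>M i\<in>{..<k}. lborel))
        = (\<Prod>i<k. G i (b i) - G i (a i))"
      using product_integral_prod[OF finite_lessThan int] 1
      by (simp add: has_bochner_integral_iff)
  qed
qed

text \<open>The indicator of a box, written as a product so that its integral factorises.\<close>

definition cell :: "nat \<Rightarrow> (nat \<Rightarrow> real) \<Rightarrow> (nat \<Rightarrow> real) \<Rightarrow> (nat \<Rightarrow> real) \<Rightarrow> real" where
  "cell k a b z = (\<Prod>i<k. indicator {a i..b i} (z i))"

lemma cell_eq: "cell k a b z = (if \<forall>i<k. a i \<le> z i \<and> z i \<le> b i then 1 else 0)"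
  by (auto simp: cell_def indicator_def intro!: prod_zero)

lemma integral_cell_volume:
  assumes "\<And>i. i < k \<Longrightarrow> a i \<le> b i"
  shows "has_bochner_integral (\<Pi>\<^sub>M i\<in>{..<k}. lborel) (cell k a b) (\<Prod>i<k. b i - a i)"
  using integral_cell[of k a b "\<lambda>_ x. x" "\<lambda>_ _. 1"] assms
  by (simp add: cell_def[abs_def])

text \<open>The mean of the squared deviation over an interval of half length \<open>s\<close> is
  \<open>s\<^sup>2 / 3\<close>, and each of the \<open>k\<close> coordinates contributes this mean
  times the volume.\<close>

lemma integral_cell_moment:
  assumes "0 \<le> s"
  shows "has_bochner_integral (\<Pi>\<^sub>M i\<in>{..<k}. lborel)
    (\<lambda>z. cell k (\<lambda>i. p i - s) (\<lambda>i. p i + s) z * (edist k z p)\<^sup>2) (real k * ((2 * s) ^ k * (s\<^sup>2 / 3)))"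
proof -
  have one: "has_bochner_integral (\<Pi>\<^sub>M i\<in>{..<k}. lborel)
      (\<lambda>z. cell k (\<lambda>i. p i - s) (\<lambda>i. p i + s) z * (z j - p j)\<^sup>2) ((2 * s) ^ k * (s\<^sup>2 / 3))"
    if j: "j < k" for j
  proof -
    define g where "g i x = (if i = j then (x - p j)\<^sup>2 else 1)" for i x
    define G where "G i x = (if i = j then (x - p j) ^ 3 / 3 else x)" for i x
    have "has_bochner_integral (\<Pi>\<^sub>M i\<in>{..<k}. lborel)
      (\<lambda>z. \<Prod>i<k. g i (z i) * indicator {p i - s..p i + s} (z i)) (\<Prod>i<k. G i (p i + s) - G i (p i - s))"
    proof (rule integral_cell)
      show "(G i has_real_derivative g i x) (at x)" for i x
        unfolding G_def g_def by (auto intro!: derivative_eq_intros)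
      show "isCont (g i) x" for i x
        unfolding g_def by (cases "i = j") auto
    qed (use assms in auto)
    also have "(\<lambda>z. \<Prod>i<k. g i (z i) * indicator {p i - s..p i + s} (z i)) =
        (\<lambda>z. cell k (\<lambda>i. p i - s) (\<lambda>i. p i + s) z * (z j - p j)\<^sup>2)"
      unfolding cell_def g_def prod.distrib using j by (simp add: prod.delta mult.commute)
    also have "(\<Prod>i<k. G i (p i + s) - G i (p i - s)) = (\<Prod>i<k. (2 * s) * (if i = j then s\<^sup>2 / 3 else 1))"
      unfolding G_def by (intro prod.cong) (auto simp: power3_eq_cube power2_eq_square)
    also have "\<dots> = (2 * s) ^ k * (s\<^sup>2 / 3)"
      unfolding prod.distrib using j by (simp add: prod.delta)
    finally show ?thesis .
  qed
  have "has_bochner_integral (\<Pi>\<^sub>M i\<in>{..<k}. lborel)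
    (\<lambda>z. \<Sum>j<k. cell k (\<lambda>i. p i - s) (\<lambda>i. p i + s) z * (z j - p j)\<^sup>2) (\<Sum>j<k. (2 * s) ^ k * (s\<^sup>2 / 3))"
    by (intro has_bochner_integral_sum one) auto
  then show ?thesis by (simp add: edist_sq sum_distrib_left)
qed

text \<open>
  Integrate Blichfeldt's inequality over boxes of half side \<open>\<sigma> c i\<close> around the points \<open>p i\<close>:
  on average the squared distance to the centre is only a third of the maximal one, and
  \<open>8 \<sigma>\<^sup>2 < 3\<close>. All boxes lie in a cube of side \<open>1 + 0.36 \<sigma> \<le> 2 \<sigma>\<close>.
\<close>

lemma sum_powers_short:
  fixes p :: "'i \<Rightarrow> nat \<Rightarrow> real" and c :: "'i \<Rightarrow> real"
  assumes fin: "finite I" and k: "1 \<le> k" and c: "\<And>i. i \<in> I \<Longrightarrow> 0 < c i \<and> c i \<le> 18/100"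
    and p: "\<And>i n. i \<in> I \<Longrightarrow> n < k \<Longrightarrow> 0 \<le> p i n \<and> p i n \<le> 1"
    and sep: "\<And>i j. i \<in> I \<Longrightarrow> j \<in> I \<Longrightarrow> i \<noteq> j \<Longrightarrow>
      ((c i)\<^sup>2 + (c j)\<^sup>2) * real k / 8 \<le> (edist k (p i) (p j))\<^sup>2"
  shows "(\<Sum>i\<in>I. c i ^ k) \<le> 200"
proof -
  \<comment> \<open>The window is narrow: \<open>1 + 0.36 * \<sigma> \<le> 2 * \<sigma>\<close>
    needs \<sigma> at least about 0.6098, and \<open>8 * \<sigma>\<^sup>2 < 3\<close> needs it below
    about 0.6124. The resulting constant \<open>1 / (1 - 8 / 3 * \<sigma>\<^sup>2)\<close> is below
    130.\<close>
  define \<sigma> :: real where "\<sigma> = 61/100"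
  define l where "l i = c i * sqrt k" for i
  define B where "B i = cell k (\<lambda>n. p i n - \<sigma> * c i) (\<lambda>n. p i n + \<sigma> * c i)" for i
  let ?P = "\<Pi>\<^sub>M i\<in>{..<k}. lborel :: real measure"
  let ?C = "cell k (\<lambda>_. - 18/100 * \<sigma>) (\<lambda>_. 1 + 18/100 * \<sigma>)"
  have l: "0 < l i" "(l i)\<^sup>2 = (c i)\<^sup>2 * k" if "i \<in> I" for i
    using c[OF that] k by (auto simp: l_def power_mult_distrib)
  \<comment> \<open>Only the boxes containing \<open>z\<close> count. If there are any,
    \<open>z\<close> lies in the large cube and \<open>blichfeldt\<close> with constant 1/4 bounds
    their number by 1 plus 8 times the normalised second moment.\<close>
  have pointwise: "(\<Sum>i\<in>I. B i z - 8 / (l i)\<^sup>2 * (B i z * (edist k z (p i))\<^sup>2)) \<le> ?C z" for z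
  proof -
    define J where "J = {i \<in> I. B i z = 1}"
    have J: "J \<subseteq> I" "finite J" using fin by (auto simp: J_def)
    have B01: "B i z = 0 \<or> B i z = 1" for i by (simp add: B_def cell_eq)
    have "(\<Sum>i\<in>I. B i z - 8 / (l i)\<^sup>2 * (B i z * (edist k z (p i))\<^sup>2))
        = (\<Sum>i\<in>J. 1 - 8 * ((edist k z (p i))\<^sup>2 / (l i)\<^sup>2))"
    proof (intro sum.mono_neutral_cong_right fin J(1) ballI)
      fix i assume "i \<in> I - J"
      then have "B i z = 0" using B01[of i] by (auto simp: J_def)
      then show "B i z - 8 / (l i)\<^sup>2 * (B i z * (edist k z (p i))\<^sup>2) = 0" by simp
    qed (auto simp: J_def)
    also have "\<dots> = real (card J) - 8 * (\<Sum>i\<in>J. (edist k z (p i))\<^sup>2 / (l i)\<^sup>2)"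
      by (simp add: sum_subtractf sum_distrib_left)
    also have "\<dots> \<le> ?C z"
    proof (cases "J = {}")
      case True
      then show ?thesis by (simp add: cell_eq)
    next
      case False
      then obtain i where i: "i \<in> I" "B i z = 1" by (auto simp: J_def)
      have "- 18/100 * \<sigma> \<le> z n \<and> z n \<le> 1 + 18/100 * \<sigma>" if "n < k" for n
      proof -
        have "p i n - \<sigma> * c i \<le> z n \<and> z n \<le> p i n + \<sigma> * c i"
          using i(2) that by (auto simp: B_def cell_eq split: if_splits)
        moreover have "\<sigma> * c i \<le> \<sigma> * (18/100)"
          using c[OF i(1)] by (intro mult_left_mono) (auto simp: \<sigma>_def)
        ultimately show ?thesis using p[OF i(1) that] by linarith
      qed
      then have C1: "?C z = 1" by (simp add: cell_eq)
      define S where "S = (\<Sum>i\<in>J. (edist k z (p i))\<^sup>2 / (l i)\<^sup>2)"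
      have "1 / 4 * (real (card J) - 1) / 2 \<le> S"
        unfolding S_def
      proof (rule blichfeldt)
        fix i j assume "i \<in> J" "j \<in> J" "i \<noteq> j"
        then show "1 / 4 * ((l i)\<^sup>2 + (l j)\<^sup>2) / 2 \<le> (edist k (p i) (p j))\<^sup>2"
          using sep[of i j] J l by (auto simp: subset_iff algebra_simps)
      qed (use J l in auto)
      then show ?thesis unfolding C1 S_def[symmetric] by simp
    qed
    finally show ?thesis .
  qed
  define M where "M i = (2 * (\<sigma> * c i)) ^ k" for i
  have int: "has_bochner_integral ?P (\<lambda>z. \<Sum>i\<in>I. B i z - 8 / (l i)\<^sup>2 * (B i z * (edist k z (p i))\<^sup>2))
      (\<Sum>i\<in>I. M i - 8 / (l i)\<^sup>2 * (real k * (M i * ((\<sigma> * c i)\<^sup>2 / 3))))"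
  proof (intro has_bochner_integral_sum has_bochner_integral_diff has_bochner_integral_mult_right)
    fix i assume i: "i \<in> I"
    have s: "0 \<le> \<sigma> * c i" using c[OF i] by (simp add: \<sigma>_def)
    show "has_bochner_integral ?P (B i) (M i)"
      using integral_cell_volume[of k "\<lambda>n. p i n - \<sigma> * c i" "\<lambda>n. p i n + \<sigma> * c i"] s
      by (simp add: B_def M_def)
    show "has_bochner_integral ?P (\<lambda>z. B i z * (edist k z (p i))\<^sup>2) (real k * (M i * ((\<sigma> * c i)\<^sup>2 / 3)))"
      unfolding B_def M_def by (rule integral_cell_moment[OF s])
  qed
  have C: "has_bochner_integral ?P ?C ((1 + 36/100 * \<sigma>) ^ k)"
    using integral_cell_volume[of k "\<lambda>_. - 18/100 * \<sigma>" "\<lambda>_. 1 + 18/100 * \<sigma>"]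
    by (simp add: \<sigma>_def)
  have "(\<Sum>i\<in>I. M i - 8 / (l i)\<^sup>2 * (real k * (M i * ((\<sigma> * c i)\<^sup>2 / 3)))) \<le> (1 + 36/100 * \<sigma>) ^ k"
    using integral_mono[OF integrable.intros[OF int] integrable.intros[OF C] pointwise]
    unfolding has_bochner_integral_integral_eq[OF int] has_bochner_integral_integral_eq[OF C] .
  also have "\<dots> \<le> (2 * \<sigma>) ^ k" by (intro power_mono) (auto simp: \<sigma>_def)
  also have "(\<Sum>i\<in>I. M i - 8 / (l i)\<^sup>2 * (real k * (M i * ((\<sigma> * c i)\<^sup>2 / 3))))
      = (\<Sum>i\<in>I. (2 * \<sigma>) ^ k * (1 - 8 / 3 * \<sigma>\<^sup>2) * c i ^ k)"
  proof (intro sum.cong refl)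
    fix i assume i: "i \<in> I"
    \<comment> \<open>The factor \<open>(c i)\<^sup>2\<close> cancels, so edges of all scales lose
      the same proportion of their box volume.\<close>
    have "8 / (l i)\<^sup>2 * (real k * (M i * ((\<sigma> * c i)\<^sup>2 / 3))) = M i * (8 / 3 * \<sigma>\<^sup>2)"
      using c[OF i] k l(2)[OF i] by (simp add: power_mult_distrib)
    moreover have "M i = (2 * \<sigma>) ^ k * c i ^ k" by (simp add: M_def power_mult_distrib)
    ultimately show "M i - 8 / (l i)\<^sup>2 * (real k * (M i * ((\<sigma> * c i)\<^sup>2 / 3)))
        = (2 * \<sigma>) ^ k * (1 - 8 / 3 * \<sigma>\<^sup>2) * c i ^ k" by (simp add: algebra_simps)
  qed
  finally have "(2 * \<sigma>) ^ k * ((1 - 8 / 3 * \<sigma>\<^sup>2) * (\<Sum>i\<in>I. c i ^ k)) \<le> (2 * \<sigma>) ^ k * 1"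
    by (simp add: sum_distrib_left mult.assoc)
  then have "(1 - 8 / 3 * \<sigma>\<^sup>2) * (\<Sum>i\<in>I. c i ^ k) \<le> 1"
    by (rule mult_left_le_imp_le) (simp add: \<sigma>_def)
  then show ?thesis by (simp add: \<sigma>_def power2_eq_square)
qed

subsection \<open>Long edges\<close>

lemma sum_two_values:
  fixes x y :: real
  assumes "n \<le> k"
  shows "(\<Sum>i<k. if i < n then x else y) = real n * x + (real k - real n) * y"
proof -
  have "{..<k} \<inter> {i. i < n} = {..<n}" "{..<k} \<inter> - {i. i < n} = {n..<k}" using assms by auto
  then show ?thesis using assms by (simp add: sum.If_cases of_nat_diff)
qed

lemma prod_two_values:
  fixes x y :: real
  assumes "n \<le> k"
  shows "(\<Prod>i<k. if i < n then x else y) = x ^ n * y ^ (k - n)"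
proof -
  have "{..<k} \<inter> {i. i < n} = {..<n}" "{..<k} \<inter> - {i. i < n} = {n..<k}" using assms by auto
  then show ?thesis by (simp add: prod.If_cases)
qed

text \<open>
  Apply the packing bound with a fraction \<open>\<alpha>\<close> of the coordinates cut into \<open>a + 1\<close> parts and the
  others into \<open>a\<close> parts.
\<close>

lemma sum_powers_level:
  fixes v :: "'i \<Rightarrow> nat \<Rightarrow> real" and c :: "'i \<Rightarrow> real" and a :: nat
  assumes fin: "finite I" and k: "1 \<le> k" and a: "1 \<le> a" and \<alpha>: "0 \<le> \<alpha>" "\<alpha> \<le> 1"
    and lo: "0 < lo" and hi: "0 \<le> hi" and c: "\<And>i. i \<in> I \<Longrightarrow> lo \<le> c i \<and> c i \<le> hi"
    and v: "\<And>i. i \<in> I \<Longrightarrow> v i \<in> unit_cube k" "inj_on v I"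
    and sep: "\<And>i j. i \<in> I \<Longrightarrow> j \<in> I \<Longrightarrow> i \<noteq> j \<Longrightarrow> min (c i) (c j) * sqrt k \<le> edist k (v i) (v j)"
    and small: "(\<alpha> / (real a + 1)\<^sup>2 + (1 - \<alpha>) / (real a)\<^sup>2) / 2 \<le> 199/200 * lo\<^sup>2"
    and rate: "((real a + 1) / real a) powr \<alpha> \<le> \<rho>" "real a * \<rho> * hi \<le> 1"
  shows "(\<Sum>i\<in>I. c i ^ k) \<le> 400"
proof -
  \<comment> \<open>Rounding up can only shrink the boxes, and it costs at most one extra factor
    \<open>r \<le> 2\<close> in their number.\<close>
  define n where "n = nat \<lceil>\<alpha> * k\<rceil>"
  define r where "r = (real a + 1) / real a"
  have \<alpha>k: "0 \<le> \<alpha> * k" "\<alpha> * k \<le> k" using \<alpha> by (auto simp: mult_left_le_one_le)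
  then have nk: "n \<le> k" by (simp add: n_def ceiling_le_iff)
  have "real n = of_int \<lceil>\<alpha> * k\<rceil>" using \<alpha>k(1) by (simp add: n_def)
  then have n: "\<alpha> * k \<le> n" "n \<le> \<alpha> * k + 1" by linarith+
  have r: "1 \<le> r" "r \<le> 2" using a by (auto simp: r_def field_simps)
  have \<rho>: "0 \<le> \<rho>" using rate(1) powr_ge_zero order_trans by blast
  define m where "m i = (if i < n then a + 1 else a)" for i
  have "(\<Sum>i<k. 1 / (real (m i))\<^sup>2) = (\<Sum>i<k. if i < n then 1 / (real a + 1)\<^sup>2 else 1 / (real a)\<^sup>2)"
    by (intro sum.cong) (auto simp: m_def add.commute)
  also have "\<dots> = k * (1 / (real a)\<^sup>2) - n * (1 / (real a)\<^sup>2 - 1 / (real a + 1)\<^sup>2)"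
  proof -
    have "real n * x + (real k - real n) * y = k * y - n * (y - x)" for x y :: real
      by (simp add: algebra_simps)
    then show ?thesis by (simp only: sum_two_values[OF nk])
  qed
  also have "\<dots> \<le> k * (1 / (real a)\<^sup>2) - \<alpha> * k * (1 / (real a)\<^sup>2 - 1 / (real a + 1)\<^sup>2)"
    using n a by (intro diff_left_mono mult_right_mono) (auto intro!: divide_left_mono power_mono)
  also have "\<dots> = k * (\<alpha> / (real a + 1)\<^sup>2 + (1 - \<alpha>) / (real a)\<^sup>2)"
  proof -
    have "k * y - \<alpha> * k * (y - x) = k * (\<alpha> * x + (1 - \<alpha>) * y)" for x y :: real
      by (simp add: algebra_simps)
    from this[of "1 / (real a)\<^sup>2" "1 / (real a + 1)\<^sup>2"] show ?thesis by simp
  qed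
  finally have "(\<Sum>i<k. 1 / (real (m i))\<^sup>2) / 2
      \<le> k * ((\<alpha> / (real a + 1)\<^sup>2 + (1 - \<alpha>) / (real a)\<^sup>2) / 2)" by simp
  also have "\<dots> \<le> k * (199/200 * lo\<^sup>2)" by (intro mult_left_mono small) auto
  also have "\<dots> = (1 - 1/200) * (lo * sqrt k)\<^sup>2" by (simp add: power_mult_distrib)
  finally have sum_m: "(\<Sum>i<k. 1 / (real (m i))\<^sup>2) / 2 \<le> (1 - 1/200) * (lo * sqrt k)\<^sup>2" .
  have "real (card (v ` I)) \<le> (\<Prod>i<k. real (m i)) / (1/200)"
  proof (rule packing_card[OF _ _ _ _ _ _ sum_m])
    fix x y assume "x \<in> v ` I" "y \<in> v ` I" "x \<noteq> y"
    then obtain i j where ij: "i \<in> I" "j \<in> I" "i \<noteq> j" "x = v i" "y = v j" by auto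
    have "lo * sqrt k \<le> min (c i) (c j) * sqrt k"
      using c ij by (intro mult_right_mono) auto
    then show "lo * sqrt k \<le> edist k x y" using sep[of i j] ij by auto
  qed (use fin v a lo k in \<open>auto simp: m_def\<close>)
  then have card: "real (card I) \<le> 200 * (\<Prod>i<k. real (m i))" using v(2) by (simp add: card_image)
  have "(\<Prod>i<k. real (m i)) = (\<Prod>i<k. if i < n then r * real a else real a)"
    using a by (intro prod.cong) (auto simp: m_def r_def)
  also have "\<dots> = r ^ n * real a ^ k"
    using nk unfolding prod_two_values[OF nk] by (simp add: power_mult_distrib flip: power_add)
  also have "r ^ n \<le> 2 * \<rho> ^ k"
  proof -
    have "r ^ n = r powr n" using r by (simp add: powr_realpow)
    also have "\<dots> \<le> r powr (\<alpha> * k + 1)" using n r by (intro powr_mono) auto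
    also have "\<dots> = (r powr \<alpha>) ^ k * r" using r by (simp add: powr_add powr_powr flip: powr_realpow)
    also have "\<dots> \<le> \<rho> ^ k * 2"
      using rate(1) r \<rho> by (intro mult_mono power_mono) (auto simp: r_def)
    finally show ?thesis by simp
  qed
  finally have prod: "(\<Prod>i<k. real (m i)) \<le> 2 * \<rho> ^ k * real a ^ k" by (simp add: mult_right_mono)
  \<comment> \<open>There are at most \<open>2 * (a * \<rho>) ^ k\<close> boxes with at most 200
    points each; the second rate condition balances this against \<open>hi ^ k\<close>.\<close>
  have "(\<Sum>i\<in>I. c i ^ k) \<le> (\<Sum>i\<in>I. hi ^ k)"
    using c lo by (intro sum_mono power_mono) (auto intro: order_trans[of _ lo])
  also have "\<dots> = real (card I) * hi ^ k" by simp
  also have "\<dots> \<le> (200 * (2 * \<rho> ^ k * real a ^ k)) * hi ^ k"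
    using card prod hi by (intro mult_right_mono) auto
  also have "\<dots> = 400 * (real a * \<rho> * hi) ^ k" by (simp add: power_mult_distrib)
  also have "\<dots> \<le> 400 * 1"
    using rate(2) \<rho> hi by (intro mult_left_mono power_le_one) auto
  finally show ?thesis by simp
qed

text \<open>Reduces numerical bounds on rational powers to comparisons of integer powers.\<close>

lemma powr_divide_le:
  fixes x y :: real
  assumes "0 < x" "0 \<le> y" "0 < q" "x ^ p \<le> y ^ q"
  shows "x powr (real p / real q) \<le> y"
proof -
  have "(x powr (real p / real q)) ^ q = x ^ p"
    using assms by (simp add: powr_powr flip: powr_realpow)
  then show ?thesis using assms power_mono_iff[of "x powr (real p / real q)" y q] by simp
qed

text \<open>One short range contributes 200 and seven long ranges contribute 400 each. The points
  \<open>p\<close> serve the short range, the points \<open>v\<close> the long ones.\<close>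

lemma sum_powers_bounded:
  fixes v p :: "'i \<Rightarrow> nat \<Rightarrow> real" and c :: "'i \<Rightarrow> real"
  assumes fin: "finite I" and k: "1 \<le> k" and c: "\<And>i. i \<in> I \<Longrightarrow> 0 < c i \<and> c i \<le> 1"
    and v: "\<And>i. i \<in> I \<Longrightarrow> v i \<in> unit_cube k" "inj_on v I"
    and sep: "\<And>i j. i \<in> I \<Longrightarrow> j \<in> I \<Longrightarrow> i \<noteq> j \<Longrightarrow> min (c i) (c j) * sqrt k \<le> edist k (v i) (v j)"
    and p: "\<And>i n. i \<in> I \<Longrightarrow> n < k \<Longrightarrow> 0 \<le> p i n \<and> p i n \<le> 1"
    and sep_p: "\<And>i j. i \<in> I \<Longrightarrow> j \<in> I \<Longrightarrow> i \<noteq> j \<Longrightarrow>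
      ((c i)\<^sup>2 + (c j)\<^sup>2) * real k / 8 \<le> (edist k (p i) (p j))\<^sup>2"
  shows "(\<Sum>i\<in>I. c i ^ k) \<le> 3000"
proof -
  \<comment> \<open>Cumulative sums let neighbouring ranges share their endpoint and chain by
    addition.\<close>
  define A where "A h = (\<Sum>i\<in>{i \<in> I. c i \<le> h}. c i ^ k)" for h
  have c0: "0 \<le> c i ^ k" if "i \<in> I" for i using c[OF that] by simp
  have step: "A hi \<le> A lo + 400"
    if "1 \<le> a" "0 \<le> \<alpha>" "\<alpha> \<le> 1" "0 < lo" "0 \<le> hi"
      "(\<alpha> / (real a + 1)\<^sup>2 + (1 - \<alpha>) / (real a)\<^sup>2) / 2 \<le> 199/200 * lo\<^sup>2"
      "((real a + 1) / real a) powr \<alpha> \<le> \<rho>" "real a * \<rho> * hi \<le> 1"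
    for a :: nat and \<alpha> lo hi \<rho> :: real
  proof -
    have "A hi \<le> (\<Sum>i\<in>{i \<in> I. c i \<le> lo} \<union> {i \<in> I. lo \<le> c i \<and> c i \<le> hi}. c i ^ k)"
      unfolding A_def using fin c0 by (intro sum_mono2) auto
    also have "\<dots> \<le> A lo + (\<Sum>i\<in>{i \<in> I. lo \<le> c i \<and> c i \<le> hi}. c i ^ k)"
      unfolding A_def using fin c0 by (subst sum_Un) (auto intro!: sum_nonneg)
    also have "(\<Sum>i\<in>{i \<in> I. lo \<le> c i \<and> c i \<le> hi}. c i ^ k) \<le> 400"
      by (rule sum_powers_level[of _ k a \<alpha> lo hi c v \<rho>])
        (use that fin k v sep in \<open>auto intro: inj_on_subset\<close>)
    finally show ?thesis by simp
  qed
  \<comment> \<open>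
    The thresholds leave just enough room: the lower end of each interval must exceed the
    circumradius bound \<open>sqrt (mean of 1 / m\<^sup>2) / sqrt 2\<close> of the grid, and the upper end must be at
    most the inverse of the \<open>k\<close>-th root of the number of boxes.
  \<close>
  have "A (18/100) \<le> 200"
    unfolding A_def by (rule sum_powers_short[of _ k c p]) (use fin k c p sep_p in auto)
  moreover have "A (24/100) \<le> A (18/100) + 400"
    by (rule step[of 4 0 _ _ 1]) (auto simp: power2_eq_square)
  moreover have "A (31/100) \<le> A (24/100) + 400"
    by (rule step[of 3 0 _ _ 1]) (auto simp: power2_eq_square)
  \<comment> \<open>Uniform grids leave gaps: 3 parts reach up to 1/3 and 2 parts start above
    \<open>sqrt (1/8)\<close>; likewise 2 parts reach 1/2 and the undivided cube starts above
    \<open>sqrt (1/2)\<close>. Mixed grids, with \<open>\<alpha>\<close> strictly between 0 and 1,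
    bridge them.\<close>
  moreover have "A (36/100) \<le> A (31/100) + 400"
    by (rule step[of 2 "1/2" _ _ "5/4"])
      (use powr_divide_le[of "3/2" "5/4" 2 1] in \<open>auto simp: power2_eq_square\<close>)
  moreover have "A (49/100) \<le> A (36/100) + 400"
    by (rule step[of 2 0 _ _ 1]) (auto simp: power2_eq_square)
  moreover have "A (6/10) \<le> A (49/100) + 400"
    by (rule step[of 1 "7/10" _ _ "163/100"])
      (use powr_divide_le[of 2 "163/100" 10 7] in \<open>auto simp: power2_eq_square power_divide\<close>)
  moreover have "A (71/100) \<le> A (6/10) + 400"
    by (rule step[of 1 "2/5" _ _ "7/5"])
      (use powr_divide_le[of 2 "7/5" 5 2] in \<open>auto simp: power2_eq_square power_divide\<close>)
  moreover have "A 1 \<le> A (71/100) + 400"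
    by (rule step[of 1 0 _ _ 1]) (auto simp: power2_eq_square)
  moreover have "A 1 = (\<Sum>i\<in>I. c i ^ k)"
    unfolding A_def using c by (intro sum.cong) auto
  ultimately show ?thesis by linarith
qed

subsection \<open>Trees in the cube\<close>

lemma edist_pos:
  assumes "x \<in> unit_cube k" "y \<in> unit_cube k" "x \<noteq> y"
  shows "0 < edist k x y"
proof -
  obtain i where i: "i < k" "x i \<noteq> y i"
    using PiE_ext[of x "{..<k}" "\<lambda>_. {0..1}" y] assms
    by (auto simp: unit_cube_def)
  have "0 < (\<Sum>i<k. (x i - y i)\<^sup>2)"
    by (rule sum_pos2[of _ i]) (use i in auto)
  then show ?thesis by (simp add: edist_def L2_set_def)
qed

lemma edist_le_sqrt:
  assumes "x \<in> unit_cube k" "y \<in> unit_cube k"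
  shows "edist k x y \<le> sqrt k"
proof -
  have "(\<Sum>i<k. (x i - y i)\<^sup>2) \<le> (\<Sum>i<k. 1)"
  proof (intro sum_mono)
    fix i assume "i \<in> {..<k}"
    then have "x i \<in> {0..1}" "y i \<in> {0..1}" using assms by (auto simp: unit_cube_def PiE_iff)
    then have "\<bar>x i - y i\<bar> \<le> 1" by auto
    then show "(x i - y i)\<^sup>2 \<le> 1" by (simp add: abs_square_le_1)
  qed
  then show ?thesis by (simp add: edist_def L2_set_def)
qed

text \<open>Four times the squared midpoint distance is the sum of the four squared cross distances
  minus the two squared edge lengths. The first two hypotheses absorb the negative terms, and the
  cross distance from \<open>a\<close> to \<open>d\<close> remains.\<close>

lemma midpoint_separation:
  assumes "(edist k a b)\<^sup>2 \<le> (edist k a c)\<^sup>2" "(edist k c d)\<^sup>2 \<le> (edist k b d)\<^sup>2"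
    "(edist k a b)\<^sup>2 \<le> (edist k a d)\<^sup>2" "(edist k c d)\<^sup>2 \<le> (edist k a d)\<^sup>2"
  shows "((edist k a b)\<^sup>2 + (edist k c d)\<^sup>2) / 8
    \<le> (edist k (\<lambda>n. (a n + b n) / 2) (\<lambda>n. (c n + d n) / 2))\<^sup>2"
    (is "_ \<le> ?M")
proof -
  define M where "M = ?M"
  have "4 * M
      = (edist k a c)\<^sup>2 + (edist k b d)\<^sup>2 + (edist k a d)\<^sup>2 + (edist k b c)\<^sup>2
        - (edist k a b)\<^sup>2 - (edist k c d)\<^sup>2"
    unfolding M_def edist_sq sum_distrib_left sum.distrib[symmetric] sum_subtractf[symmetric]
    by (intro sum.cong refl) (simp add: power2_eq_square field_simps)
  then have "(edist k a d)\<^sup>2 \<le> 4 * M"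
    using assms(1,2) zero_le_power2[of "edist k b c"] by linarith
  moreover have "(edist k a b)\<^sup>2 + (edist k c d)\<^sup>2 \<le> 2 * (edist k a d)\<^sup>2"
    using assms(3,4) by linarith
  ultimately have "((edist k a b)\<^sup>2 + (edist k c d)\<^sup>2) / 8 \<le> M" by simp
  then show ?thesis by (simp only: M_def)
qed

lemma sST_set_le:
  assumes k: "1 \<le> k" and X: "X \<subseteq> unit_cube k" "finite X" "X \<noteq> {}"
  shows "sST_set k X \<le> sqrt k * root k 3000"
proof -
  define w where "w e = edge_length k e ^ k" for e
  have pos: "0 < w e" if e: "e \<in> complete_edges X" for e
  proof -
    obtain x y where "e = {x, y}" "x \<in> X" "y \<in> X" "x \<noteq> y" using complete_edgesE[OF e] .
    then show ?thesis using edist_pos[of x k y] X(1) by (simp add: w_def subset_iff)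
  qed
  obtain T where "min_connected X T w"
    using min_connected_exists[of X w] X pos by blast
  then interpret min_connected X T w .
  define c where "c e = edge_length k e / sqrt k" for e
  have sk: "0 < sqrt k" using k by simp
  have len: "edge_length k e = c e * sqrt k" for e using sk by (simp add: c_def)
  have c: "0 < c e \<and> c e \<le> 1" if e: "e \<in> T" for e
  proof -
    obtain x y where "e = {x, y}" "x \<in> X" "y \<in> X" "x \<noteq> y" using edgeE[OF e] .
    then show ?thesis
      using edist_pos[of x k y] edist_le_sqrt[of x k y] X(1) sk by (simp add: c_def subset_iff)
  qed
  \<comment> \<open>Cut inequalities between \<open>k\<close>-th powers become inequalities between
    lengths, since \<open>k\<close> is positive.\<close>
  have le: "edge_length k e \<le> edist k x y" if "w e \<le> w {x, y}" for e x y
  proof -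
    have "edge_length k e ^ Suc (k - 1) \<le> edist k x y ^ Suc (k - 1)"
      using that k by (simp add: w_def)
    then show ?thesis by (rule power_le_imp_le_base) (rule edist_nonneg)
  qed
  obtain v where v: "\<And>e. e \<in> T \<Longrightarrow> v e \<in> X" "inj_on v T"
    and vsep: "\<And>e f. e \<in> T \<Longrightarrow> f \<in> T \<Longrightarrow> e \<noteq> f \<Longrightarrow> min (w e) (w f) \<le> w {v e, v f}"
    using edge_representatives by blast
  \<comment> \<open>The midpoint as a function of the edge itself, without ordering its two distinct
    endpoints.\<close>
  define p where "p e n = (\<Sum>x\<in>e. x n) / 2" for e :: "(nat \<Rightarrow> real) set" and n
  have p: "p {x, y} = (\<lambda>n. (x n + y n) / 2)" if "x \<noteq> y" for x y
    using that by (simp add: p_def[abs_def])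
  have "(\<Sum>e\<in>T. c e ^ k) \<le> 3000"
  proof (rule sum_powers_bounded[of _ k c v p])
    fix e f assume ef: "e \<in> T" "f \<in> T" "e \<noteq> f"
    show "min (c e) (c f) * sqrt k \<le> edist k (v e) (v f)"
      using vsep[OF ef] le[of e "v e" "v f"] le[of f "v e" "v f"] sk
      by (auto simp: min_le_iff_disj min_mult_distrib_right len)
    obtain a b c' d where *: "e = {a, b}" "f = {c', d}" "a \<noteq> b" "c' \<noteq> d"
      "w e \<le> w {a, c'}" "w f \<le> w {b, d}" "w e \<le> w {a, d}" "w f \<le> w {a, d}"
      using edge_pair[OF ef] by metis
    have "((edist k a b)\<^sup>2 + (edist k c' d)\<^sup>2) / 8 \<le> (edist k (p e) (p f))\<^sup>2"
      unfolding *(1,2) p[OF *(3)] p[OF *(4)]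
      by (rule midpoint_separation)
        (use le[OF *(5)] le[OF *(6)] le[OF *(7)] le[OF *(8)] *(1,2) edist_nonneg
          in \<open>auto intro: power_mono\<close>)
    moreover have "edist k a b = c e * sqrt k" "edist k c' d = c f * sqrt k"
      using len[of e] len[of f] * by auto
    ultimately show "((c e)\<^sup>2 + (c f)\<^sup>2) * real k / 8 \<le> (edist k (p e) (p f))\<^sup>2"
      by (simp add: power_mult_distrib algebra_simps)
  next
    fix e n assume e: "e \<in> T" and n: "n < k"
    obtain x y where xy: "e = {x, y}" "x \<in> X" "y \<in> X" "x \<noteq> y" using edgeE[OF e] .
    then have "x n \<in> {0..1}" "y n \<in> {0..1}" using X n by (auto simp: unit_cube_def PiE_iff)
    then show "0 \<le> p e n \<and> p e n \<le> 1" using p[OF xy(4)] xy(1) by auto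
  qed (use finite_T k c v X in auto)
  then have "sqrt k ^ k * (\<Sum>e\<in>T. c e ^ k) \<le> sqrt k ^ k * 3000"
    by (rule mult_left_mono) simp
  then have "(\<Sum>e\<in>T. edge_length k e ^ k) \<le> sqrt k ^ k * 3000"
    by (simp add: len power_mult_distrib sum_distrib_left mult.commute[of _ "sqrt k ^ k"])
  then have "tree_cost k T \<le> root k (sqrt k ^ k * 3000)"
    unfolding tree_cost_def using k by (intro real_root_le_mono) auto
  also have "\<dots> = sqrt k * root k 3000"
    using k by (simp add: real_root_mult real_root_power_cancel)
  finally have "tree_cost k T \<le> sqrt k * root k 3000" .
  moreover have "sST_set k X \<le> tree_cost k T"
    unfolding sST_set_def using spanning_tree finite_spanning_trees[OF X(2)] by (intro Min_le) auto
  ultimately show ?thesis by linarith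
qed

lemma sST_le:
  assumes "1 \<le> k"
  shows "sST k \<le> ereal (sqrt k * root k 3000)"
  unfolding sST_def sST_num_def
proof (intro SUP_least, clarsimp)
  fix X assume X: "X \<subseteq> unit_cube k" "2 \<le> card X"
  \<comment> \<open>An infinite set has \<open>card\<close> equal to 0, so it is excluded
    here.\<close>
  then have "finite X" "X \<noteq> {}" by (auto intro: card_ge_0_finite)
  then show "sST_set k X \<le> sqrt k * root k 3000" using sST_set_le assms X by blast
qed

section \<open>The lower bound and the asymptotic statement\<close>

lemma spanning_tree_doubleton:
  assumes "a \<noteq> b" "spanning_tree_on {a, b} T"
  shows "T = {{a, b}}"
proof -
  have sub: "T \<subseteq> {{a, b}}"
    using assms by (auto simp: spanning_tree_on_def complete_edges_def)
  have "reach T a b"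
    using assms by (auto simp: spanning_tree_on_def graph_connected_iff_reach)
  then have "T \<noteq> {}" using assms(1) by (auto simp: reach_def)
  then show ?thesis using sub by auto
qed

lemma sST_ge:
  assumes "1 \<le> k"
  shows "ereal (sqrt k) \<le> sST k"
proof -
  define a b :: "nat \<Rightarrow> real" where "a = (\<lambda>i\<in>{..<k}. 0)" and "b = (\<lambda>i\<in>{..<k}. 1)"
  have "a 0 \<noteq> b 0" using assms by (simp add: a_def b_def)
  then have ab: "a \<noteq> b" by auto
  have cube: "{a, b} \<subseteq> unit_cube k" by (auto simp: a_def b_def unit_cube_def)
  have dist: "edist k a b = sqrt k" by (simp add: edist_def L2_set_def a_def b_def)
  have cost: "tree_cost k T = sqrt k" if "spanning_tree_on {a, b} T" for T
    using spanning_tree_doubleton[OF ab that] dist assms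
    by (simp add: tree_cost_def real_root_power_cancel)
  \<comment> \<open>A minimiser for constant weight supplies a spanning tree, so the minimum is over
    a nonempty set.\<close>
  obtain T where "min_connected {a, b} T (\<lambda>_. 1)"
    by (rule min_connected_exists[of "{a, b}" "\<lambda>_. 1"]) auto
  then have "spanning_tree_on {a, b} T" by (rule min_connected.spanning_tree)
  then have "tree_cost k ` {T. spanning_tree_on {a, b} T} = {sqrt k}"
    using cost by (force simp: image_iff)
  then have "sST_set k {a, b} = sqrt k" by (simp add: sST_set_def)
  then have "ereal (sqrt k) \<le> sST_num k 2"
    unfolding sST_num_def using cube ab by (intro SUP_upper2[of "{a, b}"]) auto
  also have "\<dots> \<le> sST k" unfolding sST_def by (intro SUP_upper) auto
  finally show ?thesis .
qed

theorem theorem1p5: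
  shows "(\<exists>\<epsilon> :: nat \<Rightarrow> real. \<epsilon> \<longlonglongrightarrow> 0 \<and>
            (\<forall>k\<ge>1. sST k \<le> ereal (sqrt (real k) * (1 + \<epsilon> k))))
       \<and> (\<exists>\<epsilon> :: nat \<Rightarrow> real. \<epsilon> \<longlonglongrightarrow> 0 \<and>
            (\<forall>k\<ge>1. sST k \<ge> ereal (sqrt (real k) * (1 - \<epsilon> k))))"
proof
  \<comment> \<open>The absolute constant disappears in the limit because only its
    \<open>k\<close>-th root enters.\<close>
  have "(\<lambda>k. root k 3000 - 1) \<longlonglongrightarrow> 1 - 1"
    by (intro tendsto_diff LIMSEQ_root_const tendsto_const) simp
  then show "\<exists>\<epsilon> :: nat \<Rightarrow> real. \<epsilon> \<longlonglongrightarrow> 0 \<and>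
      (\<forall>k\<ge>1. sST k \<le> ereal (sqrt (real k) * (1 + \<epsilon> k)))"
    using sST_le by (intro exI[of _ "\<lambda>k. root k 3000 - 1"]) simp
  show "\<exists>\<epsilon> :: nat \<Rightarrow> real. \<epsilon> \<longlonglongrightarrow> 0 \<and>
      (\<forall>k\<ge>1. sST k \<ge> ereal (sqrt (real k) * (1 - \<epsilon> k)))"
    using sST_ge by (intro exI[of _ "\<lambda>_. 0"]) simp
qed

end
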